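(* Let $n\ge 3$ and let $P\in\mathcal P_n$ be an $n$-gon such that not all its vertices are equal. (a) $P$ has a (nonzero) central vector $v(P)$ if and only if $P$ has two centers which are not coincident. In this case, every point on the line through the centroid of $P$ with direction $v(P)$ is a center of $P$. (b) $P$ has two linearly independent central vectors $v_1(P),v_2(P)$ if and only if $P$ has three centers which are not collinear. In this case, every point in the plane is a center of $P$.
   Context: For $n\ge 3$, $\mathcal P_n$ is the set of all $n$-gons with labelled vertices in the plane, i.e. all $n$-tuples $(V_1,\ldots,V_n)$ of points of $\mathbb R^2$. Let $\rho,\sigma$ be the permutations of $\{1,\ldots,n\}$ given by $\rho(i)=i+1 \bmod n$ and $\sigma(i)=n+2-i \bmod n$ (values in $\{1,\dots,n\}$), and let $D_n$ be the dihedral group of order $2n$ they generate. Two $n$-gons $(V_i)$, $(V_i')$ differ only in their labelling if there is $\alpha\in D_n$ with $V_i'=V_{\alpha(i)}$ for all $i$. For a plane similarity $T$ (orientation-preserving or reversing), $T(P)=(T(V_1),\ldots,T(V_n))$ is similar to $P$. A subset $\mathcal F_n\subset\mathcal P_n$ is closed with respect to similarities and relabellings if every $n$-gon similar to, or differing only in its labelling from, an element of $\mathcal F_n$ is in $\mathcal F_n$; all families $\mathcal F_n$ below are assumed closed in this sense. A center (function) is a function $\Phi:\mathcal F_n\to\mathbb R^2$ such that $\Phi(T(P))=T(\Phi(P))$ for every plane similarity $T$ and $P\in\mathcal F_n$, and $\Phi(P)=\Phi(Q)$ whenever $P,Q$ differ only in their labelling. A point $X\in\mathbb R^2$ is called a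 center of a concrete $n$-gon $P$ if there exist some family $\mathcal F_n$ containing $P$ and a center function $\Phi:\mathcal F_n\to\mathbb R^2$ with $\Phi(P)=X$. A central vector (function) is a function $v:\mathcal F_n\to\mathbb R^2$ which is invariant with respect to translations ($v(P+t)=v(P)$ for $t\in\mathbb R^2$), commutes with every plane linear congruence ($v(AP)=A\,v(P)$ for every orthogonal linear map $A$), and is invariant with respect to relabellings. A concrete $P$ is said to have a central vector $w\in\mathbb R^2$ if there are some family $\mathcal F_n$ containing $P$ and a central vector function $v:\mathcal F_n\to\mathbb R^2$ with $v(P)=w$. The centroid of $P=(V_1,\ldots,V_n)$ is $\frac1n(V_1+\ldots+V_n)$. *)

theory Defs
  imports "HOL-Analysis.Analysis" "HOL-Algebra.Sym_Groups"
begin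

type_synonym point = "real^2"
type_synonym ngon = "nat \<Rightarrow> point"

text \<open>An \<open>n\<close>-gon is a tuple indexed by \<open>{1..n}\<close>; it is \<open>undefined\<close> outside that set, so that
  equality of functions is equality of tuples.\<close>

definition ngons :: "nat \<Rightarrow> ngon set" where
  "ngons n = {1..n} \<rightarrow>\<^sub>E UNIV"

text \<open>The permutations \<open>i \<mapsto> i + 1\<close> and \<open>i \<mapsto> n + 2 - i\<close> modulo \<open>n\<close>, with representatives
  taken in \<open>{1..n}\<close>, hence the shift by one around \<open>mod\<close>. They are extended by the identity, as
  \<^const>\<open>sym_group\<close> requires.\<close>

definition rot :: "nat \<Rightarrow> nat \<Rightarrow> nat" where
  "rot n i = (if i \<in> {1..n} then i mod n + 1 else i)"

definition refl_perm :: "nat \<Rightarrow> nat \<Rightarrow> nat" where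
  "refl_perm n i = (if i \<in> {1..n} then (n + 1 - i) mod n + 1 else i)"

lemma rot_permutes: "rot n permutes {1..n}"
proof (rule bij_imp_permutes)
  have "inj_on (rot n) {1..n}"
    by (rule inj_onI) (auto simp: rot_def mod_if split: if_splits)
  moreover have "rot n ` {1..n} \<subseteq> {1..n}"
    by (auto simp: rot_def Suc_le_eq)
  ultimately show "bij_betw (rot n) {1..n} {1..n}"
    by (simp add: bij_betw_def endo_inj_surj)
qed (auto simp: rot_def)

lemma refl_perm_permutes: "refl_perm n permutes {1..n}"
proof (rule bij_imp_permutes)
  have "inj_on (refl_perm n) {1..n}"
    by (rule inj_onI) (auto simp: refl_perm_def mod_if split: if_splits)
  moreover have "refl_perm n ` {1..n} \<subseteq> {1..n}"
    by (auto simp: refl_perm_def Suc_le_eq)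
  ultimately show "bij_betw (refl_perm n) {1..n} {1..n}"
    by (simp add: bij_betw_def endo_inj_surj)
qed (auto simp: refl_perm_def)

definition dihedral :: "nat \<Rightarrow> (nat \<Rightarrow> nat) set" where
  "dihedral n = generate (sym_group n) {rot n, refl_perm n}"

definition relabelled :: "nat \<Rightarrow> ngon \<Rightarrow> ngon \<Rightarrow> bool" where
  "relabelled n P Q \<longleftrightarrow> (\<exists>\<alpha>\<in>dihedral n. \<forall>i\<in>{1..n}. Q i = P (\<alpha> i))"

definition similarity :: "(point \<Rightarrow> point) \<Rightarrow> bool" where
  "similarity T \<longleftrightarrow> (\<exists>r>0. \<forall>x y. dist (T x) (T y) = r * dist x y)"

definition apply_ngon :: "nat \<Rightarrow> (point \<Rightarrow> point) \<Rightarrow> ngon \<Rightarrow> ngon" where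
  "apply_ngon n T P = (\<lambda>i\<in>{1..n}. T (P i))"

definition closed_family :: "nat \<Rightarrow> ngon set \<Rightarrow> bool" where
  "closed_family n F \<longleftrightarrow> F \<subseteq> ngons n \<and>
     (\<forall>P\<in>F. \<forall>T. similarity T \<longrightarrow> apply_ngon n T P \<in> F) \<and>
     (\<forall>P\<in>F. \<forall>Q\<in>ngons n. relabelled n P Q \<longrightarrow> Q \<in> F)"

text \<open>Functions on a family \<open>F\<close> are total functions of which only the values on \<open>F\<close> matter.\<close>

definition center_function :: "nat \<Rightarrow> ngon set \<Rightarrow> (ngon \<Rightarrow> point) \<Rightarrow> bool" where
  "center_function n F \<Phi> \<longleftrightarrow>
     (\<forall>P\<in>F. \<forall>T. similarity T \<longrightarrow> \<Phi> (apply_ngon n T P) = T (\<Phi> P)) \<and>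
     (\<forall>P\<in>F. \<forall>Q\<in>F. relabelled n P Q \<longrightarrow> \<Phi> P = \<Phi> Q)"

definition is_center :: "nat \<Rightarrow> ngon \<Rightarrow> point \<Rightarrow> bool" where
  "is_center n P X \<longleftrightarrow>
     (\<exists>F \<Phi>. closed_family n F \<and> P \<in> F \<and> center_function n F \<Phi> \<and> \<Phi> P = X)"

definition central_vector_function :: "nat \<Rightarrow> ngon set \<Rightarrow> (ngon \<Rightarrow> point) \<Rightarrow> bool" where
  "central_vector_function n F v \<longleftrightarrow>
     (\<forall>P\<in>F. \<forall>t. v (apply_ngon n (\<lambda>x. x + t) P) = v P) \<and>
     (\<forall>P\<in>F. \<forall>A. orthogonal_transformation A \<longrightarrow> v (apply_ngon n A P) = A (v P)) \<and>
     (\<forall>P\<in>F. \<forall>Q\<in>F. relabelled n P Q \<longrightarrow> v P = v Q)"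

definition is_central_vector :: "nat \<Rightarrow> ngon \<Rightarrow> point \<Rightarrow> bool" where
  "is_central_vector n P w \<longleftrightarrow>
     (\<exists>F v. closed_family n F \<and> P \<in> F \<and> central_vector_function n F v \<and> v P = w)"

definition centroid :: "nat \<Rightarrow> ngon \<Rightarrow> point" where
  "centroid n P = (1 / real n) *\<^sub>R (\<Sum>i=1..n. P i)"

text \<open>The condition \<open>v \<noteq> w\<close> is needed because \<open>{v, v} = {v}\<close>.\<close>

definition lin_indep_pair :: "point \<Rightarrow> point \<Rightarrow> bool" where
  "lin_indep_pair v w \<longleftrightarrow> v \<noteq> w \<and> independent {v, w}"

end

theory Submission
  imports Defs
begin

text \<open>The heart of the matter is that \<open>X\<close> is a center of \<open>P\<close> exactly when \<open>X - G\<close> is a central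
  vector of \<open>P\<close>, where \<open>G\<close> is the centroid (lemma \<open>is_center_iff_central_vector\<close>). If
  \<open>\<Phi>\<close> is a center function, then \<open>Q \<mapsto> \<Phi> Q - G(Q)\<close> is a central vector function on the same
  family, because the centroid is itself equivariant. Conversely, a central vector function \<open>v\<close> need
  not behave well under homotheties, so it is first made homogeneous: with the size \<open>s(Q)\<close> of a
  polygon being the sum of the distances of its vertices from its centroid, the function
  \[\Phi(Q) = G(Q) + \frac{s(Q)}{s(P)}\, v\left(\frac{s(P)}{s(Q)}\, Q\right)\]
  (read as \<open>G(Q)\<close> if \<open>s(Q) = 0\<close>) uses \<open>v\<close> only at polygons of size \<open>s(P)\<close>, is a center
  function, and satisfies \<open>\<Phi>(P) = G(P) + v(P)\<close>. This is where \<open>s(P) \<noteq> 0\<close> is needed, that is,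
  that the vertices of \<open>P\<close> are not all equal.

  Central vectors of \<open>P\<close> form a linear subspace of the plane (lemma \<open>central_vector_lincomb\<close>), since
  central vector functions can be combined on the intersection of their families. So the centers
  of \<open>P\<close> form the affine subspace through \<open>G\<close> with that direction, and both parts of the theorem
  become statements about the dimension of this subspace.\<close>

section \<open>Similarities and relabellings\<close>

lemma similarity_decompose:
  assumes "similarity T"
  obtains r A b where "r > 0" "orthogonal_transformation A" "T = (\<lambda>x. r *\<^sub>R A x + b)"
proof -
  obtain r where r: "r > 0" "\<And>x y. dist (T x) (T y) = r * dist x y"
    using assms by (auto simp: similarity_def)
  define A where "A = (\<lambda>x. (1 / r) *\<^sub>R (T x - T 0))"
  have "dist (A x) (A y) = dist x y" for x y
  proof -
    have "A x - A y = (1 / r) *\<^sub>R (T x - T y)"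
      by (simp add: A_def algebra_simps)
    then have "dist (A x) (A y) = (1 / r) * dist (T x) (T y)"
      using r(1) by (simp add: dist_norm)
    then show ?thesis using r by simp
  qed
  moreover have "A 0 = 0" by (simp add: A_def)
  ultimately have "orthogonal_transformation A"
    by (simp add: orthogonal_transformation_isometry)
  moreover have "T = (\<lambda>x. r *\<^sub>R A x + T 0)"
    using r(1) by (simp add: A_def)
  ultimately show ?thesis using that r(1) by blast
qed

lemma dist_affine:
  fixes A :: "point \<Rightarrow> point"
  assumes "r > 0" "orthogonal_transformation A"
  shows "dist (r *\<^sub>R A x + b) (r *\<^sub>R A y + b) = r * dist x y"
proof -
  have "dist (r *\<^sub>R A x + b) (r *\<^sub>R A y + b) = norm (r *\<^sub>R (A x - A y))"
    by (simp add: dist_norm scaleR_diff_right)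
  also have "\<dots> = r * dist (A x) (A y)"
    using assms(1) by (simp add: dist_norm)
  also have "dist (A x) (A y) = dist x y"
    using assms(2) by (simp add: orthogonal_transformation_isometry)
  finally show ?thesis .
qed

lemma similarity_affine:
  assumes "r > 0" "orthogonal_transformation A"
  shows "similarity (\<lambda>x. r *\<^sub>R A x + b)"
  using dist_affine[OF assms] assms(1) unfolding similarity_def by blast

lemma similarity_orthogonal: "orthogonal_transformation A \<Longrightarrow> similarity A"
  using similarity_affine[of 1 A 0] by simp

lemma similarity_translation: "similarity (\<lambda>x. x + t)"
  using similarity_affine[of 1 id t] by (simp add: orthogonal_transformation_id id_def)

lemma similarity_scaleR: "r > 0 \<Longrightarrow> similarity (\<lambda>x. r *\<^sub>R x)"
  using similarity_affine[of r id 0] by (simp add: orthogonal_transformation_id id_def)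

lemma apply_ngon_compose: "apply_ngon n S (apply_ngon n T P) = apply_ngon n (S \<circ> T) P"
  by (auto simp: apply_ngon_def)

lemma apply_ngon_id: "P \<in> ngons n \<Longrightarrow> apply_ngon n (\<lambda>x. x) P = P"
  by (auto simp: apply_ngon_def ngons_def PiE_def extensional_restrict)

lemma dihedral_permutes:
  assumes "\<alpha> \<in> dihedral n"
  shows "\<alpha> permutes {1..n}"
proof -
  have "{rot n, refl_perm n} \<subseteq> carrier (sym_group n)"
    using rot_permutes refl_perm_permutes by (simp add: sym_group_def)
  then have "\<alpha> \<in> carrier (sym_group n)"
    using assms group.generate_in_carrier[OF sym_group_is_group] unfolding dihedral_def by blast
  then show ?thesis by (simp add: sym_group_def)
qed

lemma relabelled_apply_ngon:
  assumes "relabelled n P Q"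
  shows "relabelled n (apply_ngon n T P) (apply_ngon n T Q)"
proof -
  obtain \<alpha> where \<alpha>: "\<alpha> \<in> dihedral n" "\<forall>i\<in>{1..n}. Q i = P (\<alpha> i)"
    using assms by (auto simp: relabelled_def)
  have "\<alpha> i \<in> {1..n}" if "i \<in> {1..n}" for i
    using permutes_in_image[OF dihedral_permutes[OF \<alpha>(1)]] that by blast
  then show ?thesis
    using \<alpha> unfolding relabelled_def apply_ngon_def by (intro bexI[of _ \<alpha>]) auto
qed

lemma relabelled_sum:
  fixes f :: "point \<Rightarrow> 'a::comm_monoid_add"
  assumes "relabelled n P Q"
  shows "(\<Sum>i=1..n. f (Q i)) = (\<Sum>i=1..n. f (P i))"
proof -
  obtain \<alpha> where \<alpha>: "\<alpha> \<in> dihedral n" "\<forall>i\<in>{1..n}. Q i = P (\<alpha> i)"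
    using assms by (auto simp: relabelled_def)
  have "(\<Sum>i=1..n. f (Q i)) = (\<Sum>i=1..n. f (P (\<alpha> i)))"
    using \<alpha>(2) by (intro sum.cong) auto
  also have "\<dots> = (\<Sum>i=1..n. f (P i))"
    using sum.permute[OF dihedral_permutes[OF \<alpha>(1)], of "f \<circ> P"] by (simp add: o_def)
  finally show ?thesis .
qed

lemma closed_family_similarity:
  "closed_family n F \<Longrightarrow> Q \<in> F \<Longrightarrow> similarity T \<Longrightarrow> apply_ngon n T Q \<in> F"
  by (auto simp: closed_family_def)

lemma closed_family_Int:
  "closed_family n F \<Longrightarrow> closed_family n G \<Longrightarrow> closed_family n (F \<inter> G)"
  by (auto simp: closed_family_def)

section \<open>Centroid and size of a polygon\<close>

lemma centroid_relabelled: "relabelled n P Q \<Longrightarrow> centroid n Q = centroid n P"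
  using relabelled_sum[of n P Q "\<lambda>x. x"] by (simp add: centroid_def)

lemma centroid_similarity:
  assumes "n > 0" "similarity T"
  shows "centroid n (apply_ngon n T P) = T (centroid n P)"
proof -
  obtain r A b where rAb: "orthogonal_transformation A" "T = (\<lambda>x. r *\<^sub>R A x + b)"
    using similarity_decompose[OF assms(2)] by metis
  interpret A: linear A by (rule orthogonal_transformation_linear[OF rAb(1)])
  have "(\<Sum>i=1..n. apply_ngon n T P i) = (\<Sum>i=1..n. r *\<^sub>R A (P i) + b)"
    by (simp add: apply_ngon_def rAb(2))
  also have "\<dots> = r *\<^sub>R A (\<Sum>i=1..n. P i) + real n *\<^sub>R b"
    by (simp add: sum.distrib A.sum scaleR_sum_right sum_constant_scaleR del: sum_constant)
  finally show ?thesis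
    using assms(1) by (simp add: centroid_def rAb(2) A.scaleR scaleR_add_right)
qed

text \<open>The size of a polygon: the sum of the distances of the vertices from the centroid. It
  vanishes only if all vertices coincide.\<close>

definition ngon_size :: "nat \<Rightarrow> ngon \<Rightarrow> real" where
  "ngon_size n P = (\<Sum>i=1..n. dist (P i) (centroid n P))"

lemma ngon_size_nonneg: "ngon_size n P \<ge> 0"
  by (simp add: ngon_size_def sum_nonneg)

lemma ngon_size_pos:
  assumes "\<exists>i\<in>{1..n}. \<exists>j\<in>{1..n}. P i \<noteq> P j"
  shows "ngon_size n P > 0"
proof (rule ccontr)
  assume "\<not> ngon_size n P > 0"
  then have "ngon_size n P = 0" using ngon_size_nonneg[of n P] by linarith
  then have "\<forall>i\<in>{1..n}. P i = centroid n P"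
    unfolding ngon_size_def by (subst (asm) sum_nonneg_eq_0_iff) auto
  then show False using assms by metis
qed

lemma ngon_size_relabelled: "relabelled n P Q \<Longrightarrow> ngon_size n Q = ngon_size n P"
  using relabelled_sum[of n P Q "\<lambda>x. dist x (centroid n P)"]
  by (simp add: ngon_size_def centroid_relabelled)

lemma ngon_size_similarity:
  assumes "n > 0" "r > 0" "orthogonal_transformation A"
  shows "ngon_size n (apply_ngon n (\<lambda>x. r *\<^sub>R A x + b) P) = r * ngon_size n P"
proof -
  have "ngon_size n (apply_ngon n (\<lambda>x. r *\<^sub>R A x + b) P)
      = (\<Sum>i=1..n. dist (r *\<^sub>R A (P i) + b) (r *\<^sub>R A (centroid n P) + b))"
    unfolding ngon_size_def centroid_similarity[OF assms(1) similarity_affine[OF assms(2,3)]]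
    by (simp add: apply_ngon_def)
  also have "\<dots> = (\<Sum>i=1..n. r * dist (P i) (centroid n P))"
    by (simp only: dist_affine[OF assms(2,3)])
  finally show ?thesis by (simp add: ngon_size_def sum_distrib_left)
qed

section \<open>Centers and central vectors\<close>

lemma center_imp_central_vector:
  assumes "n > 0" "is_center n P X"
  shows "is_central_vector n P (X - centroid n P)"
proof -
  obtain F \<Phi> where F: "closed_family n F" "P \<in> F" "center_function n F \<Phi>" "\<Phi> P = X"
    using assms(2) by (auto simp: is_center_def)
  define v where "v Q = \<Phi> Q - centroid n Q" for Q
  have v: "v (apply_ngon n T Q) = T (\<Phi> Q) - T (centroid n Q)" if "Q \<in> F" "similarity T" for Q T
    using that F(3) centroid_similarity[OF assms(1) that(2)]
    by (simp add: v_def center_function_def)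
  have "central_vector_function n F v"
    unfolding central_vector_function_def
  proof (intro conjI ballI allI impI)
    fix Q t assume Q: "Q \<in> F"
    show "v (apply_ngon n (\<lambda>x. x + t) Q) = v Q"
      unfolding v[OF Q similarity_translation] by (simp add: v_def)
  next
    fix Q and A :: "point \<Rightarrow> point" assume Q: "Q \<in> F" and A: "orthogonal_transformation A"
    show "v (apply_ngon n A Q) = A (v Q)"
      unfolding v[OF Q similarity_orthogonal[OF A]]
      by (simp add: v_def linear_diff[OF orthogonal_transformation_linear[OF A]])
  next
    fix Q R assume "Q \<in> F" "R \<in> F" "relabelled n Q R"
    then show "v Q = v R"
      using F(3) by (simp add: v_def center_function_def centroid_relabelled)
  qed
  then show ?thesis
    using F(1,2,4) unfolding is_central_vector_def
    by (intro exI[of _ F] exI[of _ v]) (simp add: v_def)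
qed

lemma central_vector_imp_center:
  assumes "n > 0" "P \<in> ngons n" "\<exists>i\<in>{1..n}. \<exists>j\<in>{1..n}. P i \<noteq> P j"
    and "is_central_vector n P w"
  shows "is_center n P (centroid n P + w)"
proof -
  obtain F v where F: "closed_family n F" "P \<in> F" "central_vector_function n F v" "v P = w"
    using assms(4) by (auto simp: is_central_vector_def)
  define d where "d Q = ngon_size n Q / ngon_size n P" for Q
  have sP: "ngon_size n P > 0" by (rule ngon_size_pos[OF assms(3)])
  have d_nonneg: "d Q \<ge> 0" for Q
    using sP ngon_size_nonneg[of n Q] by (simp add: d_def)
  define N where "N Q = apply_ngon n (\<lambda>x. (1 / d Q) *\<^sub>R x) Q" for Q
  \<comment> \<open>If all vertices of \<open>Q\<close> coincide, then \<open>d Q = 0\<close> and the scaling factor \<open>1 / d Q\<close> is \<open>0\<close>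
    by convention; the value of \<open>v\<close> at \<open>N Q\<close> is then irrelevant, being multiplied by \<open>0\<close>.\<close>
  define \<Phi> where "\<Phi> Q = centroid n Q + d Q *\<^sub>R v (N Q)" for Q
  have N_in: "N Q \<in> F" if "Q \<in> F" "d Q \<noteq> 0" for Q
    unfolding N_def using that d_nonneg[of Q]
    by (intro closed_family_similarity[OF F(1)] similarity_scaleR) auto
  have "center_function n F \<Phi>"
    unfolding center_function_def
  proof (intro conjI ballI allI impI)
    fix Q T assume Q: "Q \<in> F" and T: "similarity T"
    obtain r A b where r: "r > 0" and A: "orthogonal_transformation A"
      and T_eq: "T = (\<lambda>x. r *\<^sub>R A x + b)"
      using similarity_decompose[OF T] by metis
    interpret A: linear A by (rule orthogonal_transformation_linear[OF A])
    have d_T: "d (apply_ngon n T Q) = r * d Q"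
      unfolding d_def T_eq by (simp add: ngon_size_similarity[OF assms(1) r A])
    have v_T: "v (N (apply_ngon n T Q)) = A (v (N Q))" if "d Q \<noteq> 0"
    proof -
      have "N (apply_ngon n T Q)
          = apply_ngon n (\<lambda>x. x + (1 / (r * d Q)) *\<^sub>R b) (apply_ngon n A (N Q))"
        using r unfolding N_def apply_ngon_compose d_T
        by (simp add: T_eq o_def A.scaleR scaleR_add_right)
      moreover have "apply_ngon n A (N Q) \<in> F"
        using N_in[OF Q that] by (intro closed_family_similarity[OF F(1)] similarity_orthogonal A)
      ultimately show ?thesis
        using F(3) N_in[OF Q that] A by (simp add: central_vector_function_def)
    qed
    have "\<Phi> (apply_ngon n T Q) = T (centroid n Q) + (r * d Q) *\<^sub>R A (v (N Q))"
      using v_T by (cases "d Q = 0") (auto simp: \<Phi>_def d_T centroid_similarity[OF assms(1) T])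
    also have "\<dots> = T (\<Phi> Q)"
      by (simp add: T_eq \<Phi>_def A.add A.scaleR scaleR_add_right)
    finally show "\<Phi> (apply_ngon n T Q) = T (\<Phi> Q)" .
  next
    fix Q R assume QR: "Q \<in> F" "R \<in> F" "relabelled n Q R"
    have d_eq: "d R = d Q" by (simp add: d_def ngon_size_relabelled[OF QR(3)])
    then have "relabelled n (N Q) (N R)"
      unfolding N_def by (simp add: relabelled_apply_ngon[OF QR(3)])
    then have "v (N Q) = v (N R)" if "d Q \<noteq> 0"
      using F(3) N_in[OF QR(1)] N_in[OF QR(2)] that d_eq
      by (simp add: central_vector_function_def)
    then show "\<Phi> Q = \<Phi> R"
      using d_eq by (cases "d Q = 0") (auto simp: \<Phi>_def centroid_relabelled[OF QR(3)])
  qed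
  moreover have "\<Phi> P = centroid n P + w"
  proof -
    have "d P = 1" using sP by (simp add: d_def)
    then show ?thesis by (simp add: \<Phi>_def N_def apply_ngon_id[OF assms(2)] F(4))
  qed
  ultimately show ?thesis using F(1,2) unfolding is_center_def by blast
qed

lemma is_center_iff_central_vector:
  assumes "n > 0" "P \<in> ngons n" "\<exists>i\<in>{1..n}. \<exists>j\<in>{1..n}. P i \<noteq> P j"
  shows "is_center n P X \<longleftrightarrow> is_central_vector n P (X - centroid n P)"
  using center_imp_central_vector[OF assms(1), of P X]
    central_vector_imp_center[OF assms, of "X - centroid n P"] by auto

lemma central_vector_lincomb:
  assumes "is_central_vector n P w1" "is_central_vector n P w2"
  shows "is_central_vector n P (a *\<^sub>R w1 + b *\<^sub>R w2)"
proof -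
  obtain F1 v1 where 1: "closed_family n F1" "P \<in> F1" "central_vector_function n F1 v1" "v1 P = w1"
    using assms(1) by (auto simp: is_central_vector_def)
  obtain F2 v2 where 2: "closed_family n F2" "P \<in> F2" "central_vector_function n F2 v2" "v2 P = w2"
    using assms(2) by (auto simp: is_central_vector_def)
  have lin: "A (a *\<^sub>R x + b *\<^sub>R y) = a *\<^sub>R A x + b *\<^sub>R A y"
    if "orthogonal_transformation A" for A :: "point \<Rightarrow> point" and x y
    using orthogonal_transformation_linear[OF that] by (simp add: linear_add linear_scale)
  have "central_vector_function n (F1 \<inter> F2) (\<lambda>Q. a *\<^sub>R v1 Q + b *\<^sub>R v2 Q)"
    using 1(3) 2(3) unfolding central_vector_function_def by (auto simp: lin; metis)
  then show ?thesis
    using closed_family_Int[OF 1(1) 2(1)] 1(2,4) 2(2,4) unfolding is_central_vector_def by blast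
qed

section \<open>Linear independence in the plane\<close>

lemma lin_indep_pair_iff_not_collinear: "lin_indep_pair v w \<longleftrightarrow> \<not> collinear {0, v, w}"
proof -
  have "lin_indep_pair v w \<longleftrightarrow> v \<noteq> w \<and> independent {w, v}"
    by (simp add: lin_indep_pair_def insert_commute)
  also have "\<dots> \<longleftrightarrow> v \<noteq> 0 \<and> w \<notin> span {v}"
    by (auto simp: independent_insert span_base)
  also have "\<dots> \<longleftrightarrow> v \<noteq> 0 \<and> w \<noteq> 0 \<and> \<not> (\<exists>c. w = c *\<^sub>R v)"
    by (auto simp: span_singleton image_iff intro: exI[of _ 0])
  finally show ?thesis by (auto simp: collinear_lemma)
qed

lemma lin_indep_pair_spans:
  fixes x :: point
  assumes "lin_indep_pair v w"
  obtains a b where "x = a *\<^sub>R v + b *\<^sub>R w"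
proof -
  have ind: "independent {v, w}" and card: "card {v, w} = 2"
    using assms by (auto simp: lin_indep_pair_def)
  have "(UNIV :: point set) \<subseteq> span {v, w}"
    by (rule card_ge_dim_independent[OF subset_UNIV ind]) (use card in simp)
  then have "x \<in> span {v, w}" by blast
  then show ?thesis using that
    by (auto simp: span_insert span_singleton algebra_simps)
qed

section \<open>Centers and central vectors of a nondegenerate polygon\<close>

theorem theorem6p3:
  fixes n :: nat and P :: ngon
  assumes "n \<ge> 3" and "P \<in> ngons n"
    and "\<exists>i\<in>{1..n}. \<exists>j\<in>{1..n}. P i \<noteq> P j"
  shows
    "((\<exists>w. w \<noteq> 0 \<and> is_central_vector n P w) \<longleftrightarrow>
        (\<exists>X Y. is_center n P X \<and> is_center n P Y \<and> X \<noteq> Y)) \<and>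
     (\<forall>w. w \<noteq> 0 \<and> is_central_vector n P w \<longrightarrow>
        (\<forall>t::real. is_center n P (centroid n P + t *\<^sub>R w))) \<and>
     ((\<exists>w1 w2. is_central_vector n P w1 \<and> is_central_vector n P w2 \<and> lin_indep_pair w1 w2) \<longleftrightarrow>
        (\<exists>X Y Z. is_center n P X \<and> is_center n P Y \<and> is_center n P Z \<and> \<not> collinear {X, Y, Z})) \<and>
     ((\<exists>w1 w2. is_central_vector n P w1 \<and> is_central_vector n P w2 \<and> lin_indep_pair w1 w2) \<longrightarrow>
        (\<forall>X. is_center n P X))"
proof -
  let ?G = "centroid n P"
  let ?V = "is_central_vector n P"
  have center_iff: "is_center n P X \<longleftrightarrow> ?V (X - ?G)" for X
    using assms by (intro is_center_iff_central_vector) auto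
  have line: "is_center n P (?G + t *\<^sub>R w)" if "?V w" for w t
    using central_vector_lincomb[OF that that, of t 0] by (simp add: center_iff)
  have diff: "?V (Y - X)" if "is_center n P X" "is_center n P Y" for X Y
    using central_vector_lincomb[of n P "Y - ?G" "X - ?G" 1 "-1"] that by (simp add: center_iff)
  have plane: "is_center n P X" if w: "?V w1" "?V w2" "lin_indep_pair w1 w2" for w1 w2 X
  proof -
    obtain a b where "X - ?G = a *\<^sub>R w1 + b *\<^sub>R w2"
      using lin_indep_pair_spans[OF w(3)] by metis
    then show ?thesis using central_vector_lincomb[OF w(1,2), of a b] by (simp add: center_iff)
  qed
  have two: "(\<exists>w. w \<noteq> 0 \<and> ?V w) \<longleftrightarrow> (\<exists>X Y. is_center n P X \<and> is_center n P Y \<and> X \<noteq> Y)"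
  proof
    assume "\<exists>w. w \<noteq> 0 \<and> ?V w"
    then obtain w where "w \<noteq> 0" "?V w" by blast
    then show "\<exists>X Y. is_center n P X \<and> is_center n P Y \<and> X \<noteq> Y"
      using line[of w 0] line[of w 1]
      by (intro exI[of _ ?G] exI[of _ "?G + w"]) auto
  next
    assume "\<exists>X Y. is_center n P X \<and> is_center n P Y \<and> X \<noteq> Y"
    then show "\<exists>w. w \<noteq> 0 \<and> ?V w" using diff by (metis right_minus_eq)
  qed
  have three: "(\<exists>w1 w2. ?V w1 \<and> ?V w2 \<and> lin_indep_pair w1 w2) \<longleftrightarrow>
      (\<exists>X Y Z. is_center n P X \<and> is_center n P Y \<and> is_center n P Z \<and> \<not> collinear {X, Y, Z})"
  proof
    assume "\<exists>w1 w2. ?V w1 \<and> ?V w2 \<and> lin_indep_pair w1 w2"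
    then obtain w1 w2 where w: "?V w1" "?V w2" "lin_indep_pair w1 w2" by blast
    have "\<not> collinear {w1, 0, w2}"
      using w(3) by (simp add: lin_indep_pair_iff_not_collinear insert_commute)
    then show "\<exists>X Y Z. is_center n P X \<and> is_center n P Y \<and> is_center n P Z
        \<and> \<not> collinear {X, Y, Z}"
      using plane[OF w] by blast
  next
    assume "\<exists>X Y Z. is_center n P X \<and> is_center n P Y \<and> is_center n P Z
      \<and> \<not> collinear {X, Y, Z}"
    then obtain X Y Z where c: "is_center n P X" "is_center n P Y" "is_center n P Z"
      and "\<not> collinear {X, Y, Z}" by blast
    then have "lin_indep_pair (X - Y) (Z - Y)"
      by (simp add: lin_indep_pair_iff_not_collinear collinear_3[symmetric])
    then show "\<exists>w1 w2. ?V w1 \<and> ?V w2 \<and> lin_indep_pair w1 w2"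
      using diff c by blast
  qed
  show ?thesis using two three line plane by blast
qed

end
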